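(* Let $\theta=(\alpha,-(\alpha+\gamma)/4,\gamma)$ with $(\alpha,\gamma)$ in the fourth quadrant of the real $\alpha\gamma$-plane, and let $\mathcal{R}_{\theta}(1)$ be the moduli space of $\theta$-semistable representations of the quiver $\mathbf{Q}$ (with relations $\phi_i\eta_j+\phi_j\eta_i=0$) of dimension vector $(1,4,1)$. If $\gamma<-\alpha$, then $\mathcal{R}_{\theta}(1)$ consists exactly of the (orbits of) globally surjective representations which are locally injective; if $\gamma>-\alpha$, then $\mathcal{R}_{\theta}(1)$ consists exactly of the (orbits of) globally injective representations which are locally surjective.
   Context: $\mathbf{Q}$ is the quiver with three vertices $-1,0,1$, four arrows $\eta_0,\dots,\eta_3$ from vertex $-1$ to vertex $0$ and four arrows $\phi_0,\dots,\phi_3$ from vertex $0$ to vertex $1$. A representation $R$ with maps $f_{\eta_i}$, $g_{\phi_i}$ satisfies the relations if $g_{\phi_i}f_{\eta_j}+g_{\phi_j}f_{\eta_i}=0$ for $0\le i\le j\le 3$. $R$ is globally (resp. locally) injective if $\sum\lambda_i f_{\eta_i}$ is injective for every $(\lambda_0,\dots,\lambda_3)\in\mathbb{C}^4\setminus\{0\}$ (resp. away from a subset of codimension at least 2); globally (resp. locally) surjective is defined analogously with $\sum\lambda_i g_{\phi_i}$ surjective. A representation $V$ is $\theta$-semistable (resp. $\theta$-stable) if $\theta\cdot\dim V=0$ and $\theta\cdot\dim V'\le0$ (resp. $<0$) for every nonzero proper subrepresentation $V'$. *)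

theory Defs
  imports "HOL-Analysis.Analysis"
begin

text \<open>Representations of the quiver Q (vertices -1, 0, 1; arrows eta_0..eta_3 from -1 to 0,
  arrows phi_0..phi_3 from 0 to 1) of dimension vector (1,4,1).  The vector spaces at the
  vertices are complex^1, complex^4, complex^1; arrows are indexed by the type 4;
  the map of eta_i is the 4x1 matrix f i, the map of phi_i is the 1x4 matrix g i.\<close>

type_synonym rep141 = "(4 \<Rightarrow> complex^1^4) \<times> (4 \<Rightarrow> complex^4^1)"

definition satisfies_relations :: "rep141 \<Rightarrow> bool" where
  "satisfies_relations R \<longleftrightarrow>
     (\<forall>i j. (snd R i ** fst R j) + (snd R j ** fst R i) = 0)"

text \<open>The linear combinations sum lambda_i f_eta_i and sum lambda_i g_phi_i, as linear maps.\<close>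

definition comb_f :: "rep141 \<Rightarrow> complex^4 \<Rightarrow> complex^1 \<Rightarrow> complex^4" where
  "comb_f R l = (\<lambda>v. \<Sum>i\<in>UNIV. (l $ i) *s (fst R i *v v))"

definition comb_g :: "rep141 \<Rightarrow> complex^4 \<Rightarrow> complex^4 \<Rightarrow> complex^1" where
  "comb_g R l = (\<lambda>v. \<Sum>i\<in>UNIV. (l $ i) *s (snd R i *v v))"

definition globally_injective :: "rep141 \<Rightarrow> bool" where
  "globally_injective R \<longleftrightarrow> (\<forall>l::complex^4. l \<noteq> 0 \<longrightarrow> inj (comb_f R l))"

definition globally_surjective :: "rep141 \<Rightarrow> bool" where
  "globally_surjective R \<longleftrightarrow> (\<forall>l::complex^4. l \<noteq> 0 \<longrightarrow> surj (comb_g R l))"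

text \<open>Codimension at least 2 in the parameter space C^4 (equivalently in P^3).  For dimension
  vector (1,4,1) the locus where injectivity/surjectivity fails is (the nonzero part of) a
  linear subspace of C^4, so it lies in a subset of codimension >= 2 iff it lies in a
  linear subspace of dimension <= 2.\<close>

definition codim_ge2_linear :: "(complex^4) set \<Rightarrow> bool" where
  "codim_ge2_linear Z \<longleftrightarrow> vec.subspace Z \<and> vec.dim Z \<le> 2"

definition locally_injective :: "rep141 \<Rightarrow> bool" where
  "locally_injective R \<longleftrightarrow>
     (\<exists>Z. codim_ge2_linear Z \<and> (\<forall>l::complex^4. l \<noteq> 0 \<and> l \<notin> Z \<longrightarrow> inj (comb_f R l)))"

definition locally_surjective :: "rep141 \<Rightarrow> bool" where
  "locally_surjective R \<longleftrightarrow>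
     (\<exists>Z. codim_ge2_linear Z \<and> (\<forall>l::complex^4. l \<noteq> 0 \<and> l \<notin> Z \<longrightarrow> surj (comb_g R l)))"

text \<open>Subrepresentations: triples of subspaces stable under all arrows.\<close>

definition is_subrep :: "rep141 \<Rightarrow> (complex^1) set \<Rightarrow> (complex^4) set \<Rightarrow> (complex^1) set \<Rightarrow> bool" where
  "is_subrep R W1 W0 W2 \<longleftrightarrow>
     vec.subspace W1 \<and> vec.subspace W0 \<and> vec.subspace W2 \<and>
     (\<forall>i. \<forall>w\<in>W1. fst R i *v w \<in> W0) \<and>
     (\<forall>i. \<forall>w\<in>W0. snd R i *v w \<in> W2)"

definition theta_dot :: "real \<times> real \<times> real \<Rightarrow> nat \<times> nat \<times> nat \<Rightarrow> real" where
  "theta_dot th d = fst th * real (fst d) + fst (snd th) * real (fst (snd d))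
                    + snd (snd th) * real (snd (snd d))"

definition theta_semistable :: "real \<times> real \<times> real \<Rightarrow> rep141 \<Rightarrow> bool" where
  "theta_semistable th R \<longleftrightarrow>
     theta_dot th (1, 4, 1) = 0 \<and>
     (\<forall>W1 W0 W2. is_subrep R W1 W0 W2
        \<and> \<not> (W1 = {0} \<and> W0 = {0} \<and> W2 = {0})
        \<and> \<not> (W1 = UNIV \<and> W0 = UNIV \<and> W2 = UNIV)
        \<longrightarrow> theta_dot th (vec.dim W1, vec.dim W0, vec.dim W2) \<le> 0)"

end

(*
  Encode the maps of eta_0..eta_3 as the columns of a 4x4 matrix A and those of phi_0..phi_3
  as the rows of a 4x4 matrix B; the relations say exactly that B A is skew-symmetric.
  Since the end vertices are one-dimensional, global injectivity (surjectivity) means that A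
  (resp. B) is invertible, and local injectivity (surjectivity) means that ker A (resp. ker B^T)
  has dimension at most 2.  A subrepresentation is a subspace W of C^4 together with a choice
  of 0 or C at each end vertex, subject only to range A <= W when the source is C and to
  W <= ker B when the target is 0.  If gamma < -alpha the weight at vertex 0 is positive and
  semistability means ker B = 0 and A <> 0; if gamma > -alpha it is negative and semistability
  means that A is invertible and B <> 0.  Finally, a nonzero skew-symmetric matrix has rank
  at least 2, so if B is invertible and A <> 0 then dim ker A = dim ker (B A) <= 2, and dually
  with A^T and B^T.
*)
theory Submission
  imports Defs
begin

lemma UNIV_vec_neq_zero:
  "(UNIV :: ('a::zero_neq_one^'n) set) \<noteq> {0}" "{0} \<noteq> (UNIV :: ('a^'n) set)"
proof -
  have "(1::'a^'n) \<noteq> 0" by (simp add: vec_eq_iff)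
  then show "(UNIV :: ('a^'n) set) \<noteq> {0}" "{0} \<noteq> (UNIV :: ('a^'n) set)" by auto
qed

lemma dim_proper_subspace_less:
  fixes S :: "('a::field^'n) set"
  assumes "vec.subspace S" "S \<noteq> UNIV"
  shows "vec.dim S < CARD('n)"
proof -
  have "vec.span S \<noteq> UNIV" using assms by (metis vec.span_eq_iff)
  then have "vec.dim S \<noteq> CARD('n)"
    using vec.dim_eq_full[of S] by (simp add: vec.dimension_def card_cart_basis)
  then show ?thesis using dim_subset_UNIV_cart_gen[of S] by simp
qed

lemma subspace_cart1_cases:
  fixes S :: "('a::field^1) set"
  assumes "vec.subspace S"
  obtains "S = {0}" | "S = UNIV"
proof (cases "S = UNIV")
  case False
  then have "vec.dim S = 0" using dim_proper_subspace_less[OF assms] by simp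
  then have "S = {0}" using assms vec.dim_eq_0 vec.subspace_0 by blast
  then show ?thesis using that by blast
qed (use that in blast)

lemma matrix_vector_mult_axis:
  fixes A :: "'a::comm_semiring_1^'n^'m"
  shows "A *v axis k 1 = column k A"
  by (simp add: vec_eq_iff matrix_vector_mult_def column_def axis_def if_distrib sum.delta' cong: if_cong)

lemma transpose_uminus: "transpose (- A) = - transpose (A::'a::ab_group_add^'n^'m)"
  by (simp add: vec_eq_iff transpose_def)

lemma transpose_eq_0_iff: "transpose A = 0 \<longleftrightarrow> (A::'a::zero^'n^'m) = 0"
proof -
  have "transpose (0::'a^'n^'m) = 0" by (simp add: vec_eq_iff transpose_def)
  then show ?thesis by (metis transpose_iff)
qed

lemma inj_transpose_iff:
  fixes A :: "'a::field^'n^'n"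
  shows "inj ((*v) (transpose A)) \<longleftrightarrow> inj ((*v) A)"
  by (metis matrix_left_invertible_injective left_invertible_transpose matrix_left_right_inverse)

lemma dim_kernel_skew_le:
  fixes M :: "'a::field_char_0^'n^'n"
  assumes skew: "transpose M = - M" and "M \<noteq> 0"
  shows "vec.dim {x. M *v x = 0} + 2 \<le> CARD('n)"
proof -
  obtain i j where Mij: "M $ i $ j \<noteq> 0"
    using \<open>M \<noteq> 0\<close> by (metis vec_eq_iff zero_index)
  have Mji: "M $ b $ a = - M $ a $ b" for a b
  proof -
    have "transpose M $ a $ b = (- M) $ a $ b" using skew by simp
    then show ?thesis by (simp add: transpose_def)
  qed
  have diag: "M $ k $ k = 0" for k
  proof -
    have "2 * M $ k $ k = 0" using Mji[of k k] by (metis mult_2 add.right_inverse)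
    then show ?thesis by simp
  qed
  then have "i \<noteq> j" using Mij by auto
  define K where "K = {x. M *v x = 0}"
  \<comment> \<open>Since \<open>M $ i $ j = - M $ j $ i \<noteq> 0\<close>, \<open>K\<close> meets the coordinate plane of \<open>i\<close> and \<open>j\<close>
    only in 0.\<close>
  define E where "E = {x::'a^'n. \<forall>k. k \<notin> {i, j} \<longrightarrow> x $ k = 0}"
  have "K \<inter> E \<subseteq> {0}"
  proof
    fix z assume z: "z \<in> K \<inter> E"
    then have supp: "\<forall>k. k \<notin> {i, j} \<longrightarrow> z $ k = 0" by (simp add: E_def)
    have Mz: "(M *v z) $ a = M $ a $ i * z $ i + M $ a $ j * z $ j" for a
    proof -
      have "(M *v z) $ a = (\<Sum>k\<in>UNIV. M $ a $ k * z $ k)"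
        by (simp add: matrix_vector_mult_def)
      also have "\<dots> = (\<Sum>k\<in>{i, j}. M $ a $ k * z $ k)"
        by (rule sum.mono_neutral_right) (use supp in auto)
      finally show ?thesis using \<open>i \<noteq> j\<close> by simp
    qed
    have "(M *v z) $ j = 0" "(M *v z) $ i = 0" using z by (simp_all add: K_def)
    then have "z $ i = 0" "z $ j = 0"
      using Mz[of i] Mz[of j] diag Mij Mji[of i j] by auto
    with supp show "z \<in> {0}" by (auto simp: vec_eq_iff)
  qed
  then have "vec.dim (K \<inter> E) = 0" by simp
  have "vec.subspace K" "vec.subspace E"
    unfolding K_def E_def by (rule vec.subspace_kernel, simp add: vec.subspace_def)
  from vec.dim_sums_Int[OF this]
  have "vec.dim {x + y |x y. x \<in> K \<and> y \<in> E} + vec.dim (K \<inter> E) = vec.dim K + vec.dim E" .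
  moreover have "vec.dim E = 2" unfolding E_def dim_substandard_cart using \<open>i \<noteq> j\<close> by simp
  moreover have "vec.dim {x + y |x y. x \<in> K \<and> y \<in> E} \<le> CARD('n)"
    by (rule dim_subset_UNIV_cart_gen)
  ultimately show ?thesis
    using \<open>vec.dim (K \<inter> E) = 0\<close> unfolding K_def by linarith
qed

lemma dim_kernel_le_iff_nonzero:
  fixes A B :: "'a::field_char_0^'n^'n"
  assumes "transpose (B ** A) = - (B ** A)" and "inj ((*v) B)"
  shows "vec.dim {x. A *v x = 0} + 2 \<le> CARD('n) \<longleftrightarrow> A \<noteq> 0"
proof
  assume "vec.dim {x. A *v x = 0} + 2 \<le> CARD('n)"
  then show "A \<noteq> 0" using vec_dim_card[where 'a='a and 'n='n] by auto
next
  assume "A \<noteq> 0"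
  have ker: "{x. (B ** A) *v x = 0} = {x. A *v x = 0}"
    using \<open>inj ((*v) B)\<close> by (auto simp: matrix_vector_mul_assoc[symmetric] vec.inj_iff_eq_0)
  have "B ** A \<noteq> 0"
    using \<open>A \<noteq> 0\<close> ker by (auto simp: matrix_eq)
  from dim_kernel_skew_le[OF assms(1) this] show "vec.dim {x. A *v x = 0} + 2 \<le> CARD('n)"
    by (simp only: ker)
qed

lemma exists_codim_ge2_avoiding_iff:
  assumes "vec.subspace S"
  shows "(\<exists>Z. codim_ge2_linear Z \<and> (\<forall>l. l \<noteq> 0 \<and> l \<notin> Z \<longrightarrow> l \<notin> S)) \<longleftrightarrow> vec.dim S \<le> 2"
proof
  assume "\<exists>Z. codim_ge2_linear Z \<and> (\<forall>l. l \<noteq> 0 \<and> l \<notin> Z \<longrightarrow> l \<notin> S)"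
  then obtain Z where Z: "vec.subspace Z" "vec.dim Z \<le> 2" and avoid: "\<And>l. l \<noteq> 0 \<Longrightarrow> l \<notin> Z \<Longrightarrow> l \<notin> S"
    unfolding codim_ge2_linear_def by auto
  have "S \<subseteq> Z"
  proof
    fix l assume "l \<in> S"
    show "l \<in> Z"
    proof (cases "l = 0")
      case True then show ?thesis using vec.subspace_0[OF Z(1)] by simp
    next
      case False then show ?thesis using avoid \<open>l \<in> S\<close> by auto
    qed
  qed
  show "vec.dim S \<le> 2" using vec.dim_subset[OF \<open>S \<subseteq> Z\<close>] Z(2) by linarith
next
  assume "vec.dim S \<le> 2"
  then show "\<exists>Z. codim_ge2_linear Z \<and> (\<forall>l. l \<noteq> 0 \<and> l \<notin> Z \<longrightarrow> l \<notin> S)"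
    using assms unfolding codim_ge2_linear_def by auto
qed

text \<open>Column \<open>j\<close> of \<open>eta_matrix R\<close> is the map of \<open>\<eta>\<^sub>j\<close> and row \<open>i\<close> of \<open>phi_matrix R\<close> is the
  map of \<open>\<phi>\<^sub>i\<close>, so entry \<open>(i, j)\<close> of \<open>phi_matrix R ** eta_matrix R\<close> is the composite of
  the maps of \<open>\<eta>\<^sub>j\<close> and \<open>\<phi>\<^sub>i\<close>.\<close>

definition eta_matrix :: "rep141 \<Rightarrow> complex^4^4" where
  "eta_matrix R = (\<chi> k j. fst R j $ k $ 1)"

definition phi_matrix :: "rep141 \<Rightarrow> complex^4^4" where
  "phi_matrix R = (\<chi> i k. snd R i $ 1 $ k)"

lemma skew_phi_eta:
  assumes "satisfies_relations R"
  shows "transpose (phi_matrix R ** eta_matrix R) = - (phi_matrix R ** eta_matrix R)"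
proof -
  have "(snd R i ** fst R j + snd R j ** fst R i) $ 1 $ 1 = 0" for i j
    using assms by (simp add: satisfies_relations_def)
  then show ?thesis
    by (simp add: vec_eq_iff transpose_def matrix_matrix_mult_def eta_matrix_def phi_matrix_def
        eq_neg_iff_add_eq_0 sum_1)
qed

lemma eta_apply: "fst R i *v w = w $ 1 *s column i (eta_matrix R)"
  by (simp add: vec_eq_iff matrix_vector_mult_def column_def eta_matrix_def sum_1 mult.commute)

lemma phi_apply_eq_0_iff: "(\<forall>i. snd R i *v v = 0) \<longleftrightarrow> phi_matrix R *v v = 0"
  by (simp add: vec_eq_iff matrix_vector_mult_def phi_matrix_def)

lemma comb_f_apply: "comb_f R l w = w $ 1 *s (eta_matrix R *v l)"
  by (simp add: vec_eq_iff comb_f_def matrix_vector_mult_def eta_matrix_def sum_1 sum_distrib_left mult_ac)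

lemma comb_g_apply:
  "comb_g R l v = (\<chi> _. \<Sum>k\<in>UNIV. (transpose (phi_matrix R) *v l) $ k * v $ k)"
  by (simp add: vec_eq_iff comb_g_def matrix_vector_mult_def phi_matrix_def transpose_def
      sum_distrib_left sum_distrib_right mult_ac sum_1) (rule sum.swap)

lemma inj_comb_f_iff: "inj (comb_f R l) \<longleftrightarrow> eta_matrix R *v l \<noteq> 0"
proof
  assume "inj (comb_f R l)"
  moreover have "(0::complex^1) \<noteq> 1" by (simp add: vec_eq_iff)
  ultimately have "comb_f R l 0 \<noteq> comb_f R l 1" by (meson injD)
  then show "eta_matrix R *v l \<noteq> 0" by (auto simp: comb_f_apply)
next
  assume "eta_matrix R *v l \<noteq> 0"
  then show "inj (comb_f R l)" by (auto simp: inj_def comb_f_apply vec_eq_iff)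
qed

lemma surj_comb_g_iff: "surj (comb_g R l) \<longleftrightarrow> transpose (phi_matrix R) *v l \<noteq> 0"
proof
  assume "surj (comb_g R l)"
  then obtain v where v: "comb_g R l v = 1" by (metis surj_def)
  show "transpose (phi_matrix R) *v l \<noteq> 0"
  proof
    assume "transpose (phi_matrix R) *v l = 0"
    then have "comb_g R l v = 0" by (simp add: comb_g_apply vec_eq_iff)
    then show False using v by (simp add: vec_eq_iff)
  qed
next
  assume "transpose (phi_matrix R) *v l \<noteq> 0"
  then obtain k where k: "(transpose (phi_matrix R) *v l) $ k \<noteq> 0" by (auto simp: vec_eq_iff)
  show "surj (comb_g R l)"
  proof (rule surjI)
    fix y :: "complex^1"
    show "comb_g R l (axis k (y $ 1 / (transpose (phi_matrix R) *v l) $ k)) = y"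
      using k by (simp add: comb_g_apply vec_eq_iff axis_def if_distrib cong: if_cong)
  qed
qed

lemma globally_injective_iff: "globally_injective R \<longleftrightarrow> inj ((*v) (eta_matrix R))"
  by (auto simp: globally_injective_def inj_comb_f_iff vec.inj_iff_eq_0)

lemma globally_surjective_iff: "globally_surjective R \<longleftrightarrow> inj ((*v) (phi_matrix R))"
proof -
  have "globally_surjective R \<longleftrightarrow> inj ((*v) (transpose (phi_matrix R)))"
    by (auto simp: globally_surjective_def surj_comb_g_iff vec.inj_iff_eq_0)
  then show ?thesis by (simp only: inj_transpose_iff)
qed

lemma locally_injective_iff:
  "locally_injective R \<longleftrightarrow> vec.dim {l. eta_matrix R *v l = 0} \<le> 2"
  using exists_codim_ge2_avoiding_iff[of "{l. eta_matrix R *v l = 0}"]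
  by (simp add: locally_injective_def inj_comb_f_iff vec.subspace_kernel)

lemma locally_surjective_iff:
  "locally_surjective R \<longleftrightarrow> vec.dim {l. transpose (phi_matrix R) *v l = 0} \<le> 2"
proof -
  have "vec.subspace {l. transpose (phi_matrix R) *v l = 0}"
    by (rule vec.subspace_kernel)
  from exists_codim_ge2_avoiding_iff[OF this] show ?thesis
    by (simp add: locally_surjective_def surj_comb_g_iff)
qed

lemma eta_maps_into_iff:
  assumes "vec.subspace W1" "vec.subspace W0"
  shows "(\<forall>i. \<forall>w\<in>W1. fst R i *v w \<in> W0) \<longleftrightarrow> (W1 \<noteq> {0} \<longrightarrow> range ((*v) (eta_matrix R)) \<subseteq> W0)"
  using assms(1)
proof (cases rule: subspace_cart1_cases)
  case 1
  then show ?thesis using vec.subspace_0[OF assms(2)] by simp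
next
  case 2
  have "(\<forall>i. \<forall>w. fst R i *v w \<in> W0) \<longleftrightarrow> (\<forall>i. column i (eta_matrix R) \<in> W0)"
  proof
    assume "\<forall>i. \<forall>w. fst R i *v w \<in> W0"
    then have "fst R i *v 1 \<in> W0" for i by blast
    then show "\<forall>i. column i (eta_matrix R) \<in> W0" by (simp add: eta_apply)
  next
    assume "\<forall>i. column i (eta_matrix R) \<in> W0"
    then show "\<forall>i. \<forall>w. fst R i *v w \<in> W0" by (simp add: eta_apply vec.subspace_scale[OF assms(2)])
  qed
  also have "\<dots> \<longleftrightarrow> range ((*v) (eta_matrix R)) \<subseteq> W0"
  proof
    assume "\<forall>i. column i (eta_matrix R) \<in> W0"
    then show "range ((*v) (eta_matrix R)) \<subseteq> W0"
      unfolding matrix_mult_sum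
      by (auto intro: vec.subspace_sum[OF assms(2)] vec.subspace_scale[OF assms(2)])
  next
    assume "range ((*v) (eta_matrix R)) \<subseteq> W0"
    then show "\<forall>i. column i (eta_matrix R) \<in> W0"
      by (metis matrix_vector_mult_axis rangeI subsetD)
  qed
  finally show ?thesis using 2 by (simp add: UNIV_vec_neq_zero)
qed

lemma phi_maps_into_iff:
  assumes "vec.subspace W2"
  shows "(\<forall>i. \<forall>v\<in>W0. snd R i *v v \<in> W2) \<longleftrightarrow> (W2 = {0} \<longrightarrow> W0 \<subseteq> {v. phi_matrix R *v v = 0})"
  using assms
proof (cases rule: subspace_cart1_cases)
  case 1
  then show ?thesis using phi_apply_eq_0_iff[of R] by blast
next
  case 2
  then show ?thesis by (simp add: UNIV_vec_neq_zero)
qed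

lemma is_subrep_iff:
  "is_subrep R W1 W0 W2 \<longleftrightarrow>
     vec.subspace W1 \<and> vec.subspace W0 \<and> vec.subspace W2 \<and>
     (W1 \<noteq> {0} \<longrightarrow> range ((*v) (eta_matrix R)) \<subseteq> W0) \<and>
     (W2 = {0} \<longrightarrow> W0 \<subseteq> {v. phi_matrix R *v v = 0})"
  unfolding is_subrep_def using eta_maps_into_iff phi_maps_into_iff by blast

lemma theta_semistable_triple_iff:
  "theta_semistable (\<alpha>, \<beta>, \<gamma>) R \<longleftrightarrow> \<alpha> + 4 * \<beta> + \<gamma> = 0 \<and>
     (\<forall>W1 W0 W2. is_subrep R W1 W0 W2 \<and> \<not> (W1 = {0} \<and> W0 = {0} \<and> W2 = {0})
        \<and> \<not> (W1 = UNIV \<and> W0 = UNIV \<and> W2 = UNIV)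
        \<longrightarrow> \<alpha> * vec.dim W1 + \<beta> * vec.dim W0 + \<gamma> * vec.dim W2 \<le> 0)"
  by (simp add: theta_semistable_def theta_dot_def mult.commute)

lemma theta_semistable_iff_of_pos:
  fixes \<alpha> \<beta> \<gamma> :: real
  assumes "\<alpha> > 0" "\<beta> > 0" "\<alpha> + 4 * \<beta> + \<gamma> = 0"
  shows "theta_semistable (\<alpha>, \<beta>, \<gamma>) R \<longleftrightarrow> inj ((*v) (phi_matrix R)) \<and> eta_matrix R \<noteq> 0"
proof
  assume "theta_semistable (\<alpha>, \<beta>, \<gamma>) R"
  note destabilizing = this[unfolded theta_semistable_triple_iff, THEN conjunct2, rule_format]
  define K where "K = {v. phi_matrix R *v v = 0}"
  have "K = {0}"
  proof (rule ccontr)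
    assume "K \<noteq> {0}"
    moreover have "is_subrep R {0} K {0}"
      by (simp add: is_subrep_iff K_def vec.subspace_kernel vec.subspace_single_0)
    ultimately have "\<beta> * vec.dim K \<le> 0"
      using destabilizing[of "{0}" K "{0}"] by (simp add: UNIV_vec_neq_zero)
    then have "K \<subseteq> {0}" using \<open>\<beta> > 0\<close> by (simp add: mult_le_0_iff)
    then show False using \<open>K \<noteq> {0}\<close> K_def by auto
  qed
  then have "inj ((*v) (phi_matrix R))" by (auto simp: vec.inj_iff_eq_0 K_def)
  moreover have "eta_matrix R \<noteq> 0"
  proof
    assume "eta_matrix R = 0"
    then have "is_subrep R UNIV {0} {0}"
      by (auto simp: is_subrep_iff vec.subspace_single_0)
    then have "\<alpha> * vec.dim (UNIV :: (complex^1) set) \<le> 0"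
      using destabilizing[of UNIV "{0}" "{0}"] by (simp add: UNIV_vec_neq_zero)
    then show False using \<open>\<alpha> > 0\<close> by (simp add: card_cart_basis)
  qed
  ultimately show "inj ((*v) (phi_matrix R)) \<and> eta_matrix R \<noteq> 0" ..
next
  assume "inj ((*v) (phi_matrix R)) \<and> eta_matrix R \<noteq> 0"
  then have ker: "{v. phi_matrix R *v v = 0} = {0}" and "eta_matrix R \<noteq> 0"
    by (auto simp: vec.inj_iff_eq_0)
  show "theta_semistable (\<alpha>, \<beta>, \<gamma>) R"
    unfolding theta_semistable_triple_iff
  proof (intro conjI allI impI)
    fix W1 W0 W2
    assume "is_subrep R W1 W0 W2 \<and> \<not> (W1 = {0} \<and> W0 = {0} \<and> W2 = {0})
        \<and> \<not> (W1 = UNIV \<and> W0 = UNIV \<and> W2 = UNIV)"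
    then have sub: "is_subrep R W1 W0 W2" and nonzero: "\<not> (W1 = {0} \<and> W0 = {0} \<and> W2 = {0})"
      by auto
    have "W2 \<noteq> {0}"
    proof
      assume "W2 = {0}"
      then have "W0 = {0}" using sub ker by (auto simp: is_subrep_iff vec.subspace_0)
      then have "range ((*v) (eta_matrix R)) \<subseteq> {0}" using sub nonzero \<open>W2 = {0}\<close> by (simp add: is_subrep_iff)
      then show False using \<open>eta_matrix R \<noteq> 0\<close> by (auto simp: matrix_eq)
    qed
    then have "W2 = UNIV" using sub by (auto simp: is_subrep_iff elim: subspace_cart1_cases)
    have "\<alpha> * vec.dim W1 \<le> \<alpha> * 1" "\<beta> * vec.dim W0 \<le> \<beta> * 4"
      using dim_subset_UNIV_cart_gen[of W1] dim_subset_UNIV_cart_gen[of W0] assms(1,2) by simp_all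
    then show "\<alpha> * vec.dim W1 + \<beta> * vec.dim W0 + \<gamma> * vec.dim W2 \<le> 0"
      using \<open>W2 = UNIV\<close> assms(3) by (simp add: card_cart_basis)
  qed (rule assms(3))
qed

lemma theta_semistable_iff_of_neg:
  fixes \<alpha> \<beta> \<gamma> :: real
  assumes "\<beta> < 0" "\<gamma> < 0" "\<alpha> + 4 * \<beta> + \<gamma> = 0"
  shows "theta_semistable (\<alpha>, \<beta>, \<gamma>) R \<longleftrightarrow> inj ((*v) (eta_matrix R)) \<and> phi_matrix R \<noteq> 0"
proof
  assume "theta_semistable (\<alpha>, \<beta>, \<gamma>) R"
  note destabilizing = this[unfolded theta_semistable_triple_iff, THEN conjunct2, rule_format]
  have "surj ((*v) (eta_matrix R))"
  proof (rule ccontr)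
    define W where "W = range ((*v) (eta_matrix R))"
    assume "\<not> surj ((*v) (eta_matrix R))"
    then have "W \<noteq> UNIV" by (simp add: W_def)
    have "vec.subspace W"
      unfolding W_def by (rule vec.subspace_image[OF vec.subspace_UNIV])
    then have "is_subrep R UNIV W UNIV"
      by (simp add: is_subrep_iff W_def UNIV_vec_neq_zero)
    then have "\<alpha> + \<beta> * vec.dim W + \<gamma> \<le> 0"
      using destabilizing[of UNIV W UNIV] \<open>W \<noteq> UNIV\<close> by (simp add: UNIV_vec_neq_zero card_cart_basis)
    moreover have "real (vec.dim W) \<le> 3"
      using dim_proper_subspace_less[OF \<open>vec.subspace W\<close> \<open>W \<noteq> UNIV\<close>] by simp
    then have "\<beta> * 3 \<le> \<beta> * vec.dim W"
      using \<open>\<beta> < 0\<close> by (intro mult_left_mono_neg) auto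
    ultimately show False using assms by linarith
  qed
  then have "inj ((*v) (eta_matrix R))"
    by (rule vec.linear_surj_imp_inj[OF matrix_vector_mul_linear_gen])
  moreover have "phi_matrix R \<noteq> 0"
  proof
    assume "phi_matrix R = 0"
    then have "is_subrep R UNIV UNIV {0}"
      by (simp add: is_subrep_iff vec.subspace_single_0)
    then have "\<alpha> + \<beta> * 4 \<le> 0"
      using destabilizing[of UNIV UNIV "{0}"] by (simp add: UNIV_vec_neq_zero card_cart_basis)
    then show False using assms by linarith
  qed
  ultimately show "inj ((*v) (eta_matrix R)) \<and> phi_matrix R \<noteq> 0" ..
next
  assume "inj ((*v) (eta_matrix R)) \<and> phi_matrix R \<noteq> 0"
  then have "surj ((*v) (eta_matrix R))" and "phi_matrix R \<noteq> 0"
    using vec.linear_inj_imp_surj[OF matrix_vector_mul_linear_gen] by auto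
  show "theta_semistable (\<alpha>, \<beta>, \<gamma>) R"
    unfolding theta_semistable_triple_iff
  proof (intro conjI allI impI)
    fix W1 W0 W2
    assume "is_subrep R W1 W0 W2 \<and> \<not> (W1 = {0} \<and> W0 = {0} \<and> W2 = {0})
        \<and> \<not> (W1 = UNIV \<and> W0 = UNIV \<and> W2 = UNIV)"
    then have sub: "is_subrep R W1 W0 W2" and proper: "\<not> (W1 = UNIV \<and> W0 = UNIV \<and> W2 = UNIV)"
      by auto
    have "W1 = {0}"
    proof (rule ccontr)
      assume "W1 \<noteq> {0}"
      then have "W1 = UNIV" using sub by (auto simp: is_subrep_iff elim: subspace_cart1_cases)
      have "W0 = UNIV" using sub \<open>W1 \<noteq> {0}\<close> \<open>surj ((*v) (eta_matrix R))\<close> by (auto simp: is_subrep_iff)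
      have "W2 \<noteq> {0}"
      proof
        assume "W2 = {0}"
        then have "\<forall>v. phi_matrix R *v v = 0" using sub \<open>W0 = UNIV\<close> by (auto simp: is_subrep_iff)
        then show False using \<open>phi_matrix R \<noteq> 0\<close> by (simp add: matrix_eq)
      qed
      then have "W2 = UNIV" using sub by (auto simp: is_subrep_iff elim: subspace_cart1_cases)
      then show False using proper \<open>W1 = UNIV\<close> \<open>W0 = UNIV\<close> by simp
    qed
    moreover have "\<beta> * vec.dim W0 \<le> 0" "\<gamma> * vec.dim W2 \<le> 0"
      using assms(1,2) by (simp_all add: mult_nonpos_nonneg)
    ultimately show "\<alpha> * vec.dim W1 + \<beta> * vec.dim W0 + \<gamma> * vec.dim W2 \<le> 0" by simp
  qed (rule assms(3))
qed

theorem mainTheorem2: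
  fixes \<alpha> \<gamma> :: real
  assumes "\<alpha> > 0" and "\<gamma> < 0"
  shows "(\<gamma> < - \<alpha> \<longrightarrow>
            (\<forall>R. satisfies_relations R \<longrightarrow>
               (theta_semistable (\<alpha>, - (\<alpha> + \<gamma>) / 4, \<gamma>) R \<longleftrightarrow>
                  globally_surjective R \<and> locally_injective R)))
       \<and> (\<gamma> > - \<alpha> \<longrightarrow>
            (\<forall>R. satisfies_relations R \<longrightarrow>
               (theta_semistable (\<alpha>, - (\<alpha> + \<gamma>) / 4, \<gamma>) R \<longleftrightarrow>
                  globally_injective R \<and> locally_surjective R)))"
proof (intro conjI impI allI)
  fix R assume "\<gamma> < - \<alpha>" and rel: "satisfies_relations R"
  then have "theta_semistable (\<alpha>, - (\<alpha> + \<gamma>) / 4, \<gamma>) R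
      \<longleftrightarrow> inj ((*v) (phi_matrix R)) \<and> eta_matrix R \<noteq> 0"
    using assms by (intro theta_semistable_iff_of_pos) (auto simp: field_simps)
  also have "\<dots> \<longleftrightarrow> globally_surjective R \<and> locally_injective R"
    using dim_kernel_le_iff_nonzero[OF skew_phi_eta[OF rel]]
    by (auto simp: globally_surjective_iff locally_injective_iff)
  finally show "theta_semistable (\<alpha>, - (\<alpha> + \<gamma>) / 4, \<gamma>) R
      \<longleftrightarrow> globally_surjective R \<and> locally_injective R" .
next
  fix R assume "\<gamma> > - \<alpha>" and rel: "satisfies_relations R"
  then have "theta_semistable (\<alpha>, - (\<alpha> + \<gamma>) / 4, \<gamma>) R
      \<longleftrightarrow> inj ((*v) (eta_matrix R)) \<and> phi_matrix R \<noteq> 0"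
    using assms by (intro theta_semistable_iff_of_neg) (auto simp: field_simps)
  also have "\<dots> \<longleftrightarrow> globally_injective R \<and> locally_surjective R"
  proof -
    let ?A = "transpose (phi_matrix R)" and ?B = "transpose (eta_matrix R)"
    have "transpose (?B ** ?A) = - (?B ** ?A)"
      using skew_phi_eta[OF rel] by (simp add: matrix_transpose_mul[symmetric] transpose_uminus)
    from dim_kernel_le_iff_nonzero[OF this] show ?thesis
      by (auto simp: globally_injective_iff locally_surjective_iff inj_transpose_iff transpose_eq_0_iff)
  qed
  finally show "theta_semistable (\<alpha>, - (\<alpha> + \<gamma>) / 4, \<gamma>) R
      \<longleftrightarrow> globally_injective R \<and> locally_surjective R" .
qed

end
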